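(* Let $G=(V,E)$ be a finite graph (loops and multiple edges allowed) with $|V|=m$ and $|E|=n$, and let $f\in\mathrm{Harm}_d(n)$. Then for any label $s:E\to\{1,\dots,n\}$ of $G$, $$\chi_f(G(s);\lambda)=(-1)^{\rho(E)+d}\,\lambda^{k(G)}\,T_f(M_G(s);1-\lambda,0),$$ where $M_G$ is the graphic matroid of $G$, $\rho$ its rank function, and $k(G)$ the number of connected components of $G$.
   Context: Let $\Omega=\{1,\dots,n\}$ and $\Omega_d=\{Z\subset\Omega:|Z|=d\}$. Real-valued functions $f$ on $\Omega_d$ are identified with formal sums $f=\sum_{Z\in\Omega_d}f(Z)Z$ in $\mathbb R\Omega_d$. Let $\gamma$ be the linear map with $\gamma(Z)=\sum_{Y\in\Omega_{d-1},\,Y\subset Z}Y$ for $Z\in\Omega_d$; $\mathrm{Harm}_d(n)=\ker(\gamma|_{\mathbb R\Omega_d})$ is the space of (discrete) harmonic functions of degree $d$. For $X\subset\Omega$ put $\widetilde f(X)=\sum_{Z\in\Omega_d,\,Z\subset X}f(Z)$. A label of $G$ is a bijection $s:E\to\Omega$; it is also a label of $M_G$, whose ground set is $E$. For $A\subset E$, $G_A=(V,A)$, $k(G_A)$ is its number of connected components, and the rank function of $M_G$ is $\rho(A)=|V|-k(G_A)$. Definitions: $$\chi_f(G(s);\lambda)=\sum_{A\subset E}\widetilde f(s(E\setminus A))(-1)^{|A|}\lambda^{k(G_A)},$$ $$T_f(M_G(s);x,y)=\sum_{A\subset E}\widetilde f(s(A))(x-1)^{\rho(E)-\rho(A)}(y-1)^{|A|-\rho(A)}.$$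 *)

theory Defs
  imports Complex_Main
begin

section \<open>Finite undirected multigraphs\<close>

record ('v, 'e) multigraph =
  verts :: "'v set"
  edges :: "'e set"
  ends :: "'e \<Rightarrow> 'v set"

text \<open>A loop has one end; parallel edges are distinct edges with equal sets of ends.\<close>

locale finite_multigraph =
  fixes G :: "('v, 'e) multigraph"
  assumes finite_verts: "finite (verts G)"
    and finite_edges: "finite (edges G)"
    and ends_subset: "e \<in> edges G \<Longrightarrow> ends G e \<subseteq> verts G"
    and card_ends: "e \<in> edges G \<Longrightarrow> card (ends G e) = 1 \<or> card (ends G e) = 2"

definition spanning_subgraph :: "('v, 'e) multigraph \<Rightarrow> 'e set \<Rightarrow> ('v, 'e) multigraph" where
  "spanning_subgraph G A = G\<lparr>edges := A\<rparr>"

definition adjacency :: "('v, 'e) multigraph \<Rightarrow> 'v rel" where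
  "adjacency G = {(u, v). \<exists>e \<in> edges G. ends G e = {u, v}}"

definition linked :: "('v, 'e) multigraph \<Rightarrow> 'v rel" where
  "linked G = {(u, v). u \<in> verts G \<and> v \<in> verts G \<and> (u, v) \<in> (adjacency G)\<^sup>*}"

definition num_components :: "('v, 'e) multigraph \<Rightarrow> nat" where
  "num_components G = card (verts G // linked G)"


section \<open>Matroids given by rank functions\<close>

record 'e rank_matroid =
  ground :: "'e set"
  rank :: "'e set \<Rightarrow> nat"

locale finite_matroid =
  fixes M :: "'e rank_matroid"
  assumes finite_ground: "finite (ground M)"
    and rank_le_card: "A \<subseteq> ground M \<Longrightarrow> rank M A \<le> card A"
    and rank_mono: "A \<subseteq> B \<Longrightarrow> B \<subseteq> ground M \<Longrightarrow> rank M A \<le> rank M B"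
    and rank_submodular: "A \<subseteq> ground M \<Longrightarrow> B \<subseteq> ground M \<Longrightarrow>
      rank M (A \<union> B) + rank M (A \<inter> B) \<le> rank M A + rank M B"

text \<open>
  The subtraction does not truncate, by \<open>num_components_le\<close> below.  That this is the cycle
  matroid of the graph is shown by \<open>finite_matroid_graphic_matroid\<close> and
  \<open>graphic_matroid_independent_iff\<close>.
\<close>

definition graphic_matroid :: "('v, 'e) multigraph \<Rightarrow> 'e rank_matroid" where
  "graphic_matroid G = \<lparr>ground = edges G,
     rank = (\<lambda>A. card (verts G) - num_components (spanning_subgraph G A))\<rparr>"


section \<open>Discrete harmonic functions\<close>

definition subsets_of_card :: "nat \<Rightarrow> nat \<Rightarrow> nat set set" where
  "subsets_of_card n d = {Z. Z \<subseteq> {1..n} \<and> card Z = d}"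

text \<open>
  A formal sum of subsets of \<open>{1..n}\<close> is represented by its coefficient function, which
  vanishes on all other sets; the elements of \<open>formal_sums n d\<close> are thus the real functions on
  \<open>subsets_of_card n d\<close>, extended by zero.
\<close>

definition formal_sums :: "nat \<Rightarrow> nat \<Rightarrow> (nat set \<Rightarrow> real) set" where
  "formal_sums n d = {f. \<forall>Z. Z \<notin> subsets_of_card n d \<longrightarrow> f Z = 0}"

text \<open>
  The condition \<open>Suc (card Y) = card Z\<close>, rather than \<open>card Y = card Z - 1\<close>, makes the
  image of the empty set zero.
\<close>

definition gamma_basis :: "nat set \<Rightarrow> nat set \<Rightarrow> real" where
  "gamma_basis Z = (\<lambda>Y. if Y \<subseteq> Z \<and> Suc (card Y) = card Z then 1 else 0)"

definition gamma :: "nat \<Rightarrow> (nat set \<Rightarrow> real) \<Rightarrow> nat set \<Rightarrow> real" where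
  "gamma n f = (\<lambda>Y. \<Sum>Z\<in>Pow {1..n}. f Z * gamma_basis Z Y)"

definition Harm :: "nat \<Rightarrow> nat \<Rightarrow> (nat set \<Rightarrow> real) set" where
  "Harm d n = {f \<in> formal_sums n d. gamma n f = (\<lambda>Y. 0)}"

definition tilde :: "nat \<Rightarrow> nat \<Rightarrow> (nat set \<Rightarrow> real) \<Rightarrow> nat set \<Rightarrow> real" where
  "tilde n d f X = (\<Sum>Z \<in> {Z \<in> subsets_of_card n d. Z \<subseteq> X}. f Z)"


section \<open>Weighted chromatic and Tutte polynomials\<close>

definition is_label :: "'e set \<Rightarrow> ('e \<Rightarrow> nat) \<Rightarrow> bool" where
  "is_label E s \<longleftrightarrow> bij_betw s E {1..card E}"

definition weighted_chromatic ::
  "nat \<Rightarrow> (nat set \<Rightarrow> real) \<Rightarrow> ('v, 'e) multigraph \<Rightarrow> ('e \<Rightarrow> nat) \<Rightarrow> real \<Rightarrow> real" where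
  "weighted_chromatic d f G s lam =
     (\<Sum>A \<in> Pow (edges G). tilde (card (edges G)) d f (s ` (edges G - A)) * (- 1) ^ card A
        * lam ^ num_components (spanning_subgraph G A))"

text \<open>
  The exponents are natural numbers because a rank function is monotone and bounded by the
  cardinality; \<open>0 ^ 0 = 1\<close>, as required for values of polynomials.
\<close>

definition weighted_Tutte ::
  "nat \<Rightarrow> (nat set \<Rightarrow> real) \<Rightarrow> 'e rank_matroid \<Rightarrow> ('e \<Rightarrow> nat) \<Rightarrow> real \<Rightarrow> real \<Rightarrow> real" where
  "weighted_Tutte d f M s x y =
     (\<Sum>A \<in> Pow (ground M). tilde (card (ground M)) d f (s ` A)
        * (x - 1) ^ (rank M (ground M) - rank M A) * (y - 1) ^ (card A - rank M A))"


section \<open>The graphic matroid is the cycle matroid\<close>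

lemma adjacency_spanning_insert:
  assumes "ends G e = {u, v}"
  shows "adjacency (spanning_subgraph G (insert e A)) =
    adjacency (spanning_subgraph G A) \<union> {(u, v), (v, u)}"
  using assms unfolding adjacency_def spanning_subgraph_def by (auto simp: doubleton_eq_iff)

lemma sym_adjacency: "sym (adjacency G)"
  unfolding adjacency_def sym_def by (auto simp: insert_commute)

lemma equiv_linked: "equiv (verts G) (linked G)"
proof (rule equivI)
  show "linked G \<subseteq> verts G \<times> verts G" by (auto simp: linked_def)
  show "refl_on (verts G) (linked G)" by (auto simp: refl_on_def linked_def)
  show "sym (linked G)"
    using sym_rtrancl[OF sym_adjacency[of G]] by (auto simp: sym_def linked_def)
  show "trans (linked G)" by (auto simp: trans_def linked_def intro: rtrancl_trans)
qed

lemma num_components_le: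
  assumes "finite (verts G)"
  shows "num_components G \<le> card (verts G)"
  unfolding num_components_def quotient_def UNION_singleton_eq_range
  by (rule card_image_le[OF assms])

lemma linked_mono: "A \<subseteq> B \<Longrightarrow> linked (spanning_subgraph G A) \<subseteq> linked (spanning_subgraph G B)"
proof -
  assume "A \<subseteq> B"
  then have "adjacency (spanning_subgraph G A) \<subseteq> adjacency (spanning_subgraph G B)"
    by (auto simp: adjacency_def spanning_subgraph_def)
  from rtrancl_mono[OF this] show ?thesis
    by (auto simp: linked_def spanning_subgraph_def)
qed

lemma verts_spanning [simp]: "verts (spanning_subgraph G A) = verts G"
  by (simp add: spanning_subgraph_def)

context finite_multigraph
begin

lemma obtain_ends:
  assumes "e \<in> edges G"
  obtains u v where "ends G e = {u, v}" "u \<in> verts G" "v \<in> verts G"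
proof -
  have "\<exists>u v. ends G e = {u, v}"
    using card_ends[OF assms] by (metis card_1_singletonE card_2_iff insert_absorb2)
  then show ?thesis using that ends_subset[OF assms] by auto
qed

lemma linked_insert:
  fixes A :: "'e set"
  assumes e: "ends G e = {u, v}" and uv: "u \<in> verts G" "v \<in> verts G"
  defines "R \<equiv> linked (spanning_subgraph G A)"
  shows "linked (spanning_subgraph G (insert e A)) =
    R \<union> (R `` {u} \<union> R `` {v}) \<times> (R `` {u} \<union> R `` {v})" (is "?L = ?R")
proof
  define r where "r = adjacency (spanning_subgraph G A)"
  let ?C = "R `` {u} \<union> R `` {v}"
  have eq: "equiv (verts G) R" unfolding R_def using equiv_linked[of "spanning_subgraph G A"] by simp
  have rR: "(x, y) \<in> R \<longleftrightarrow> x \<in> verts G \<and> y \<in> verts G \<and> (x, y) \<in> r\<^sup>*" for x y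
    by (auto simp: R_def linked_def r_def)
  have sy: "(x, y) \<in> R \<Longrightarrow> (y, x) \<in> R" for x y using eq by (meson equivE symE)
  have tr: "(x, y) \<in> R \<Longrightarrow> (y, z) \<in> R \<Longrightarrow> (x, z) \<in> R" for x y z using eq by (meson equivE transE)
  have re: "x \<in> verts G \<Longrightarrow> (x, x) \<in> R" for x by (simp add: rR)
  have adj': "adjacency (spanning_subgraph G (insert e A)) = r \<union> {(u, v), (v, u)}"
    unfolding r_def by (rule adjacency_spanning_insert[OF e])
  have "(x, y) \<in> ?R" if "(x, y) \<in> (r \<union> {(u, v), (v, u)})\<^sup>*" "x \<in> verts G" "y \<in> verts G" for x y
  proof -
    have "(x, y) \<in> r\<^sup>* \<or> ((x, u) \<in> r\<^sup>* \<or> (x, v) \<in> r\<^sup>*) \<and> ((u, y) \<in> r\<^sup>* \<or> (v, y) \<in> r\<^sup>*)"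
      using that(1)
    proof (induction rule: rtrancl_induct)
      case base
      then show ?case by simp
    next
      case (step y z)
      then show ?case by (auto intro: rtrancl_into_rtrancl)
    qed
    then have "(x, y) \<in> R \<or> ((x, u) \<in> R \<or> (x, v) \<in> R) \<and> ((u, y) \<in> R \<or> (v, y) \<in> R)"
      using that(2,3) uv by (auto simp: rR)
    then show ?thesis using sy by auto
  qed
  then show "?L \<subseteq> ?R" by (auto simp: linked_def adj')
  have mono: "R \<subseteq> ?L" unfolding R_def by (rule linked_mono) auto
  have eqL: "equiv (verts G) ?L" using equiv_linked[of "spanning_subgraph G (insert e A)"] by simp
  have uvL: "(u, v) \<in> ?L" using uv by (auto simp: linked_def adj')
  have CL: "(u, x) \<in> ?L" if "x \<in> ?C" for x
    using that mono uvL eqL by (auto elim!: equivE dest: transD)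
  have "(x, y) \<in> ?L" if "x \<in> ?C" "y \<in> ?C" for x y
    using CL[OF that(1)] CL[OF that(2)] eqL by (meson equivE symE transE)
  then show "?R \<subseteq> ?L" using mono by auto
qed

lemma num_components_insert:
  assumes e: "ends G e = {u, v}" and uv: "u \<in> verts G" "v \<in> verts G"
  shows "num_components (spanning_subgraph G A) =
    num_components (spanning_subgraph G (insert e A)) +
    (if (u, v) \<in> linked (spanning_subgraph G A) then 0 else 1)"
proof -
  define R where "R = linked (spanning_subgraph G A)"
  define S where "S = linked (spanning_subgraph G (insert e A))"
  let ?C = "R `` {u} \<union> R `` {v}"
  have S: "S = R \<union> ?C \<times> ?C" unfolding S_def R_def by (rule linked_insert[OF e uv])
  have eq: "equiv (verts G) R" unfolding R_def using equiv_linked[of "spanning_subgraph G A"] by simp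
  have sy: "(x, y) \<in> R \<Longrightarrow> (y, x) \<in> R" for x y using eq by (meson equivE symE)
  have tr: "(x, y) \<in> R \<Longrightarrow> (y, z) \<in> R \<Longrightarrow> (x, z) \<in> R" for x y z using eq by (meson equivE transE)
  have re: "x \<in> verts G \<Longrightarrow> (x, x) \<in> R" for x using eq by (meson equivE refl_onD)
  have nc: "num_components (spanning_subgraph G A) = card (verts G // R)"
    "num_components (spanning_subgraph G (insert e A)) = card (verts G // S)"
    by (simp_all add: num_components_def R_def S_def)
  show ?thesis
  proof (cases "(u, v) \<in> R")
    case True
    then have "?C \<times> ?C \<subseteq> R" using sy tr by blast
    then have "S = R" using S by auto
    then show ?thesis using True nc by (simp add: R_def)
  next
    case False
    let ?Q = "verts G // R - {R `` {u}, R `` {v}}"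
    have SC: "S `` {x} = ?C" if "x \<in> ?C" for x using S that sy tr by blast
    have SR: "S `` {x} = R `` {x}" if "x \<notin> ?C" for x using S that by blast
    have sub: "S `` {x} \<in> insert ?C ?Q" if "x \<in> verts G" for x
    proof (cases "x \<in> ?C")
      case True
      then show ?thesis using SC by simp
    next
      case False
      then have "R `` {x} \<noteq> R `` {u}" "R `` {x} \<noteq> R `` {v}"
        using re[OF that] by auto
      then show ?thesis using SR[OF False] that by (auto intro: quotientI)
    qed
    have C: "?C \<in> verts G // S"
      using SC[of u] re[OF uv(1)] uv(1) by (metis Image_singleton_iff UnI1 quotientI)
    have Q': "X \<in> verts G // S" if X: "X \<in> ?Q" for X
    proof -
      obtain x where x: "x \<in> verts G" "X = R `` {x}" using X by (auto elim: quotientE)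
      have "x \<notin> ?C"
        using X x(2) equiv_class_eq[OF eq] by auto
      then show ?thesis using SR x by (metis quotientI)
    qed
    have Q: "verts G // S = insert ?C ?Q"
    proof
      show "verts G // S \<subseteq> insert ?C ?Q"
      proof
        fix X
        assume "X \<in> verts G // S"
        then obtain x where x: "x \<in> verts G" "X = S `` {x}" by (rule quotientE)
        show "X \<in> insert ?C ?Q" unfolding x(2) by (rule sub[OF x(1)])
      qed
      show "insert ?C ?Q \<subseteq> verts G // S"
        unfolding insert_subset
      proof (rule conjI[OF C], rule subsetI)
        fix X
        assume "X \<in> ?Q"
        then show "X \<in> verts G // S" by (rule Q')
      qed
    qed
    have fin: "finite (verts G // R)"
      using finite_verts eq by (meson equivE finite_quotient)
    have ne: "R `` {u} \<noteq> R `` {v}" using False re[OF uv(2)] by auto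
    have mem: "R `` {u} \<in> verts G // R" "R `` {v} \<in> verts G // R" using uv by (auto intro: quotientI)
    have "?C \<notin> ?Q"
    proof
      assume "?C \<in> ?Q"
      then have "?C \<in> verts G // R" by simp
      then obtain x where x: "?C = R `` {x}" by (rule quotientE)
      have "u \<in> ?C" using re uv by auto
      then have "(x, u) \<in> R" unfolding x by simp
      then have "?C = R `` {u}" unfolding x by (rule equiv_class_eq[OF eq])
      then show False using \<open>?C \<in> ?Q\<close> by auto
    qed
    then have "card (verts G // S) = Suc (card ?Q)" using Q fin by simp
    moreover have "card ?Q = card (verts G // R) - 2"
      using fin mem ne by (subst card_Diff_subset) auto
    moreover have "card (verts G // R) \<ge> 2"
      using card_mono[OF fin, of "{R `` {u}, R `` {v}}"] mem ne by simp
    ultimately show ?thesis using False nc by (simp add: R_def)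
  qed
qed

lemma rank_insert:
  assumes "e \<in> edges G"
  shows "rank (graphic_matroid G) (insert e A) = rank (graphic_matroid G) A +
    (if ends G e \<times> ends G e \<subseteq> linked (spanning_subgraph G A) then 0 else 1)"
proof -
  obtain u v where e: "ends G e = {u, v}" and uv: "u \<in> verts G" "v \<in> verts G"
    using obtain_ends[OF assms] .
  have eq: "equiv (verts G) (linked (spanning_subgraph G A))"
    using equiv_linked[of "spanning_subgraph G A"] by simp
  have "ends G e \<times> ends G e \<subseteq> linked (spanning_subgraph G A) \<longleftrightarrow> (u, v) \<in> linked (spanning_subgraph G A)"
    using eq uv e by (auto elim!: equivE dest: symD refl_onD)
  moreover have "num_components (spanning_subgraph G A) \<le> card (verts G)"
    using num_components_le[of "spanning_subgraph G A"] finite_verts by simp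
  ultimately show ?thesis
    using num_components_insert[OF e uv, of A] by (simp add: graphic_matroid_def split: if_splits)
qed

lemma rank_empty: "rank (graphic_matroid G) {} = 0"
proof -
  have "linked (spanning_subgraph G {}) = Id_on (verts G)"
    by (auto simp: linked_def adjacency_def spanning_subgraph_def)
  then have "verts G // linked (spanning_subgraph G {}) = (\<lambda>x. {x}) ` verts G"
    by (auto simp: quotient_def)
  then show ?thesis by (simp add: graphic_matroid_def num_components_def card_image)
qed

lemma rank_union_marginal:
  assumes "S \<subseteq> T" "D \<subseteq> edges G"
  shows "rank (graphic_matroid G) (T \<union> D) + rank (graphic_matroid G) S
    \<le> rank (graphic_matroid G) T + rank (graphic_matroid G) (S \<union> D)"
proof -
  have "finite D" using assms(2) finite_edges finite_subset by blast
  then show ?thesis using assms(2)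
  proof (induction D)
    case empty
    then show ?case by simp
  next
    case (insert e D)
    have "linked (spanning_subgraph G (S \<union> D)) \<subseteq> linked (spanning_subgraph G (T \<union> D))"
      by (rule linked_mono) (use assms in auto)
    then show ?case
      using insert rank_insert[of e "S \<union> D"] rank_insert[of e "T \<union> D"] by (auto split: if_splits)
  qed
qed

lemma rank_union_bounds:
  assumes "D \<subseteq> edges G"
  shows "rank (graphic_matroid G) A \<le> rank (graphic_matroid G) (A \<union> D) \<and>
    rank (graphic_matroid G) (A \<union> D) \<le> rank (graphic_matroid G) A + card D"
proof -
  have "finite D" using assms finite_edges finite_subset by blast
  then show ?thesis using assms
  proof (induction D)
    case empty
    then show ?case by simp
  next
    case (insert e D)
    then show ?case using rank_insert[of e "A \<union> D"] by auto
  qed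
qed

lemma finite_matroid_graphic_matroid: "finite_matroid (graphic_matroid G)"
proof
  have gr: "ground (graphic_matroid G) = edges G" by (simp add: graphic_matroid_def)
  show "finite (ground (graphic_matroid G))" using finite_edges gr by simp
  fix A B
  show "rank (graphic_matroid G) A \<le> card A" if "A \<subseteq> ground (graphic_matroid G)"
    using rank_union_bounds[of A "{}"] that gr rank_empty by simp
  show "rank (graphic_matroid G) A \<le> rank (graphic_matroid G) B"
    if "A \<subseteq> B" "B \<subseteq> ground (graphic_matroid G)"
    using rank_union_bounds[of B A] that gr by (simp add: Un_absorb1)
  show "rank (graphic_matroid G) (A \<union> B) + rank (graphic_matroid G) (A \<inter> B)
      \<le> rank (graphic_matroid G) A + rank (graphic_matroid G) B"
    if "A \<subseteq> ground (graphic_matroid G)" "B \<subseteq> ground (graphic_matroid G)"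
  proof -
    have "(A \<inter> B) \<union> (B - A) = B" "A \<union> (B - A) = A \<union> B" by auto
    then show ?thesis using rank_union_marginal[of "A \<inter> B" A "B - A"] that gr by auto
  qed
qed

text \<open>
  The right-hand side says that \<open>A\<close> contains no cycle: no edge of \<open>A\<close> has its ends
  joined in the graph of the other edges of \<open>A\<close>.
\<close>

lemma graphic_matroid_independent_iff:
  assumes "A \<subseteq> edges G"
  shows "rank (graphic_matroid G) A = card A \<longleftrightarrow>
    (\<forall>e\<in>A. \<not> ends G e \<times> ends G e \<subseteq> linked (spanning_subgraph G (A - {e})))"
proof
  have fin: "finite A" using assms finite_edges finite_subset by blast
  assume r: "rank (graphic_matroid G) A = card A"
  show "\<forall>e\<in>A. \<not> ends G e \<times> ends G e \<subseteq> linked (spanning_subgraph G (A - {e}))"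
  proof (intro ballI notI)
    fix e
    assume e: "e \<in> A" and "ends G e \<times> ends G e \<subseteq> linked (spanning_subgraph G (A - {e}))"
    then have "rank (graphic_matroid G) A = rank (graphic_matroid G) (A - {e})"
      using rank_insert[of e "A - {e}"] assms by (auto simp: insert_absorb)
    also have "\<dots> \<le> card (A - {e})"
      using rank_union_bounds[of "A - {e}" "{}"] assms rank_empty by auto
    also have "\<dots> < card A" using e fin by (rule card_Diff1_less[rotated])
    finally show False using r by simp
  qed
next
  assume acyc: "\<forall>e\<in>A. \<not> ends G e \<times> ends G e \<subseteq> linked (spanning_subgraph G (A - {e}))"
  have "finite A" using assms finite_edges finite_subset by blast
  then show "rank (graphic_matroid G) A = card A" using assms acyc
  proof (induction A)
    case empty
    then show ?case by (simp add: rank_empty)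
  next
    case (insert e A)
    have "\<not> ends G x \<times> ends G x \<subseteq> linked (spanning_subgraph G (A - {x}))" if "x \<in> A" for x
      using insert.prems(2) that linked_mono[of "A - {x}" "insert e A - {x}" G] by blast
    moreover have "\<not> ends G e \<times> ends G e \<subseteq> linked (spanning_subgraph G A)"
      using insert.prems(2) insert.hyps(2) by simp
    ultimately show ?case using insert rank_insert[of e A] by simp
  qed
qed

end

end

theory Submission
  imports Defs
begin

text \<open>
  For harmonic \<open>f\<close> of degree \<open>d\<close>, the sum of \<open>f\<close> over the \<open>d\<close>-sets containing a fixed set \<open>W\<close>
  vanishes whenever \<open>W\<close> has fewer than \<open>d\<close> elements.  Hence only \<open>d\<close>-sets \<open>W\<close> survive in the
  inclusion-exclusion formula for the sum of \<open>f\<close> over the \<open>d\<close>-sets disjoint from \<open>X\<close>, and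
  complementation multiplies the extension of \<open>f\<close> by \<open>(- 1) ^ d\<close>.  Together with
  \<open>k(G\<^sub>A) = k(G) + \<rho>(E) - \<rho>(A)\<close> this identifies the two sums term by term.
\<close>

lemma finite_subsets_of_card: "finite (subsets_of_card n d)"
  by (rule finite_subset[of _ "Pow {1..n}"]) (auto simp: subsets_of_card_def)

text \<open>Expand the product over \<open>A\<close> of the factors \<open>- 1 + 1\<close>, whose
  value is \<open>0 ^ card A\<close>.\<close>

lemma sum_Pow_minus_one_power_card:
  assumes "finite A"
  shows "(\<Sum>B\<in>Pow A. (- 1) ^ card B) = (if A = {} then 1 else 0 :: 'a :: comm_ring_1)"
  using prod_add[OF assms, of "\<lambda>_. - 1 :: 'a" "\<lambda>_. 1"] assms by (simp add: power_0_left)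

text \<open>Induction on the gap \<open>d - card W - 1\<close>. Gap zero is harmonicity itself; a
  larger gap is reduced by enlarging \<open>W\<close> by one element and double counting.\<close>

lemma harmonic_sum_supersets_eq_0:
  assumes f: "f \<in> Harm d n" and "W \<subseteq> {1..n}" "card W < d"
  shows "(\<Sum>Z | Z \<in> subsets_of_card n d \<and> W \<subseteq> Z. f Z) = 0"
proof -
  obtain k where "card W + Suc k = d"
    using \<open>card W < d\<close> by (metis add_Suc_right less_iff_Suc_add)
  then show ?thesis using \<open>W \<subseteq> {1..n}\<close>
  proof (induction k arbitrary: W)
    case 0
    \<comment> \<open>Here \<open>card W = d - 1\<close>, so the sum is the coefficient of
      \<open>gamma n f\<close> at \<open>W\<close>.\<close>
    have "(\<Sum>Z | Z \<in> subsets_of_card n d \<and> W \<subseteq> Z. f Z) = gamma n f W"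
      unfolding gamma_def gamma_basis_def
    proof (rule sum.mono_neutral_cong_left)
      show "\<forall>Z\<in>Pow {1..n} - {Z \<in> subsets_of_card n d. W \<subseteq> Z}.
          f Z * (if W \<subseteq> Z \<and> Suc (card W) = card Z then 1 else 0) = 0"
        using 0 by (auto simp: subsets_of_card_def)
    qed (use 0 in \<open>auto simp: subsets_of_card_def\<close>)
    then show ?case using f by (simp add: Harm_def)
  next
    case (Suc k)
    let ?S = "{Z \<in> subsets_of_card n d. W \<subseteq> Z}"
    have fin: "finite ?S" using finite_subsets_of_card by simp
    have finW: "finite W" using Suc.prems(2) finite_subset by blast
    have IH: "(\<Sum>Z | Z \<in> ?S \<and> e \<in> Z. f Z) = 0" if "e \<in> {1..n} - W" for e
    proof -
      have "(\<Sum>Z | Z \<in> subsets_of_card n d \<and> insert e W \<subseteq> Z. f Z) = 0"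
        using Suc.prems finW that by (intro Suc.IH) auto
      moreover have "{Z \<in> subsets_of_card n d. insert e W \<subseteq> Z} = {Z. Z \<in> ?S \<and> e \<in> Z}" by auto
      ultimately show ?thesis by simp
    qed
    \<comment> \<open>Count pairs of a set \<open>Z\<close> and an element \<open>e\<close> of
      \<open>Z - W\<close>: each \<open>Z\<close> occurs \<open>d - card W = k + 2\<close> times,
      while for fixed \<open>e\<close> the sum vanishes by induction for \<open>insert e W\<close>.
      The factor \<open>k + 2\<close> is nonzero.\<close>
    have "real (Suc (Suc k)) * (\<Sum>Z\<in>?S. f Z) = (\<Sum>Z\<in>?S. \<Sum>e | e \<in> {1..n} - W \<and> e \<in> Z. f Z)"
      unfolding sum_distrib_left
    proof (rule sum.cong[OF refl])
      fix Z
      assume Z: "Z \<in> ?S"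
      then have "{e \<in> {1..n} - W. e \<in> Z} = Z - W" by (auto simp: subsets_of_card_def)
      moreover have "card (Z - W) = Suc (Suc k)"
        using Z Suc.prems finW by (simp add: card_Diff_subset subsets_of_card_def)
      ultimately show "real (Suc (Suc k)) * f Z = (\<Sum>e | e \<in> {1..n} - W \<and> e \<in> Z. f Z)" by simp
    qed
    also have "\<dots> = (\<Sum>e\<in>{1..n} - W. \<Sum>Z | Z \<in> ?S \<and> e \<in> Z. f Z)"
      by (rule sum.swap_restrict[OF fin]) simp
    also have "\<dots> = 0" using IH by (intro sum.neutral) blast
    finally show ?case by simp
  qed
qed

lemma tilde_complement:
  assumes f: "f \<in> Harm d n" and X: "X \<subseteq> {1..n}"
  shows "tilde n d f ({1..n} - X) = (- 1) ^ d * tilde n d f X"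
proof -
  let ?S = "subsets_of_card n d"
  have fin: "finite X" using X finite_subset by blast
  have "tilde n d f ({1..n} - X) = (\<Sum>Z\<in>?S. f Z * (if X \<inter> Z = {} then 1 else 0))"
    unfolding tilde_def
    by (rule sum.mono_neutral_cong_left)
      (use finite_subsets_of_card in \<open>auto simp: subsets_of_card_def\<close>)
  \<comment> \<open>Inclusion-exclusion: the indicator of \<open>X \<inter> Z = {}\<close> is the
    alternating sum over the subsets \<open>W\<close> of \<open>X \<inter> Z\<close>.\<close>
  also have "\<dots> = (\<Sum>Z\<in>?S. \<Sum>W | W \<in> Pow X \<and> W \<subseteq> Z. f Z * (- 1) ^ card W)"
  proof (rule sum.cong[OF refl])
    fix Z
    have eq: "{W \<in> Pow X. W \<subseteq> Z} = Pow (X \<inter> Z)" by auto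
    show "f Z * (if X \<inter> Z = {} then 1 else 0)
        = (\<Sum>W | W \<in> Pow X \<and> W \<subseteq> Z. f Z * (- 1) ^ card W)"
      unfolding eq sum_distrib_left[symmetric] using fin by (simp add: sum_Pow_minus_one_power_card del: Pow_Int_eq)
  qed
  also have "\<dots> = (\<Sum>W\<in>Pow X. \<Sum>Z | Z \<in> ?S \<and> W \<subseteq> Z. f Z * (- 1) ^ card W)"
    by (rule sum.swap_restrict) (use fin finite_subsets_of_card in auto)
  \<comment> \<open>If \<open>card W < d\<close>, the inner sum vanishes by harmonicity; if
    \<open>card W > d\<close>, it is empty; if \<open>card W = d\<close>, its only index is
    \<open>Z = W\<close>.\<close>
  also have "\<dots> = (\<Sum>W | W \<in> ?S \<and> W \<subseteq> X. (- 1) ^ d * f W)"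
  proof (rule sum.mono_neutral_cong_right)
    show "\<forall>W\<in>Pow X - {W \<in> ?S. W \<subseteq> X}. (\<Sum>Z | Z \<in> ?S \<and> W \<subseteq> Z. f Z * (- 1) ^ card W) = 0"
    proof
      fix W
      assume W: "W \<in> Pow X - {W \<in> ?S. W \<subseteq> X}"
      then have WX: "W \<subseteq> {1..n}" "card W \<noteq> d" using X by (auto simp: subsets_of_card_def)
      have "(\<Sum>Z | Z \<in> ?S \<and> W \<subseteq> Z. f Z) = 0"
      proof (cases "card W < d")
        case True
        then show ?thesis using harmonic_sum_supersets_eq_0[OF f] WX by blast
      next
        case False
        have "card W \<le> d" if "Z \<in> ?S" "W \<subseteq> Z" for Z
          using that card_mono[of Z W] finite_subset[of Z "{1..n}"]
          by (auto simp: subsets_of_card_def)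
        then have "{Z \<in> ?S. W \<subseteq> Z} = {}" using False WX by force
        then show ?thesis by (simp only: sum.empty)
      qed
      then show "(\<Sum>Z | Z \<in> ?S \<and> W \<subseteq> Z. f Z * (- 1) ^ card W) = 0"
        by (simp flip: sum_distrib_right)
    qed
    fix W
    assume "W \<in> {W \<in> ?S. W \<subseteq> X}"
    then have W: "W \<in> ?S" "card W = d" by (auto simp: subsets_of_card_def)
    have "W = Z" if "Z \<in> ?S" "W \<subseteq> Z" for Z
      using that W card_subset_eq[of Z W] finite_subset[of Z "{1..n}"]
      by (auto simp: subsets_of_card_def)
    then have "{Z \<in> ?S. W \<subseteq> Z} = {W}" using W by blast
    then show "(\<Sum>Z | Z \<in> ?S \<and> W \<subseteq> Z. f Z * (- 1) ^ card W) = (- 1) ^ d * f W"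
      using W by simp
  qed (use fin in auto)
  finally show ?thesis by (simp add: tilde_def sum_distrib_left)
qed

lemma spanning_subgraph_edges: "spanning_subgraph G (edges G) = G"
  by (simp add: spanning_subgraph_def)

context finite_multigraph
begin

lemma num_components_plus_rank:
  "num_components (spanning_subgraph G A) + rank (graphic_matroid G) A = card (verts G)"
  using num_components_le[of "spanning_subgraph G A"] finite_verts by (simp add: graphic_matroid_def)

text \<open>Compare \<open>num_components_plus_rank\<close> at \<open>A\<close> and at
  \<open>edges G\<close>; monotonicity of the rank keeps the subtraction from truncating.\<close>

lemma num_components_spanning_subgraph:
  assumes "A \<subseteq> edges G"
  shows "num_components (spanning_subgraph G A) = num_components G
    + (rank (graphic_matroid G) (edges G) - rank (graphic_matroid G) A)"
proof -
  interpret M: finite_matroid "graphic_matroid G" by (rule finite_matroid_graphic_matroid)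
  have "rank (graphic_matroid G) A \<le> rank (graphic_matroid G) (edges G)"
    using M.rank_mono[of A "edges G"] assms by (simp add: graphic_matroid_def)
  then show ?thesis
    using num_components_plus_rank[of A] num_components_plus_rank[of "edges G"]
    by (simp add: spanning_subgraph_edges)
qed

end

theorem theorem4p1:
  fixes G :: "('v, 'e) multigraph" and m n d :: nat
    and f :: "nat set \<Rightarrow> real" and s :: "'e \<Rightarrow> nat" and lam :: real
  assumes "finite_multigraph G"
    and "card (verts G) = m" and "card (edges G) = n"
    and "f \<in> Harm d n"
    and "is_label (edges G) s"
  shows "weighted_chromatic d f G s lam =
    (- 1) ^ (rank (graphic_matroid G) (edges G) + d) * lam ^ num_components G
      * weighted_Tutte d f (graphic_matroid G) s (1 - lam) 0"
proof -
  interpret finite_multigraph G by fact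
  interpret M: finite_matroid "graphic_matroid G" by (rule finite_matroid_graphic_matroid)
  let ?r = "rank (graphic_matroid G)"
  have gr: "ground (graphic_matroid G) = edges G" by (simp add: graphic_matroid_def)
  have s: "inj_on s (edges G)" "s ` edges G = {1..n}"
    using assms(3,5) by (auto simp: is_label_def bij_betw_def)
  have "tilde n d f (s ` (edges G - A)) * (- 1) ^ card A
      * lam ^ num_components (spanning_subgraph G A)
    = (- 1) ^ (?r (edges G) + d) * lam ^ num_components G * (tilde n d f (s ` A)
      * (1 - lam - 1) ^ (?r (edges G) - ?r A) * (0 - 1) ^ (card A - ?r A))"
    if A: "A \<subseteq> edges G" for A
  proof -
    have "s ` (edges G - A) = {1..n} - s ` A" "s ` A \<subseteq> {1..n}"
      using inj_on_image_set_diff[OF s(1) Diff_subset A] image_mono[OF A, of s] by (simp_all add: s(2))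
    then have t: "tilde n d f (s ` (edges G - A)) = (- 1) ^ d * tilde n d f (s ` A)"
      using tilde_complement[OF assms(4)] by simp
    \<comment> \<open>The corank \<open>p\<close> and the nullity \<open>q\<close> of
      \<open>A\<close> are the two exponents in the Tutte sum.\<close>
    obtain p q where pq: "?r (edges G) = ?r A + p" "card A = ?r A + q"
      using M.rank_mono[of A "edges G"] M.rank_le_card[of A] A gr by (metis le_Suc_ex order_refl)
    \<comment> \<open>The two factors \<open>(- 1) ^ p\<close> cancel: one comes from the global
      sign, the other from \<open>(1 - lam - 1) ^ p\<close>. What remains is the sign
      \<open>(- 1) ^ (d + card A)\<close> of the chromatic term.\<close>
    have "(- 1 :: real) ^ (?r A + p + d) * (- 1) ^ p * (- 1) ^ q = (- 1) ^ d * (- 1) ^ (?r A + q)"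
      by (simp add: power_add flip: power_mult_distrib)
    moreover have "(- lam) ^ p = (- 1) ^ p * lam ^ p" by (rule power_minus)
    ultimately show ?thesis
      using t num_components_spanning_subgraph[OF A] pq
      by (simp add: power_add mult_ac)
  qed
  then show ?thesis
    using assms(3)
    by (simp add: weighted_chromatic_def weighted_Tutte_def gr sum_distrib_left)
qed

end
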